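(* An episturmian word $\mathbf t$ over a finite alphabet $\mathcal A$ is quasiperiodic if and only if there exist a finite spinned word $\breve w$, a word $v\in\mathcal A^*$ (all letters with spin $L$), and a spinned version $\breve{\mathbf y}$ of an infinite word $\mathbf y\in\mathcal A^\omega$ such that $\mathbf t$ is directed by $\breve w v\breve{\mathbf y}$ and $\mathrm{Alph}(v)=\mathrm{Alph}(v\mathbf y)$.
   Context: $\mathrm{Alph}(u)$ is the set of letters of $u$. For $a\in\mathcal{A}$, $L_a,R_a$ are the morphisms with $L_a(a)=R_a(a)=a$, $L_a(b)=ab$, $R_a(b)=ba$ ($b\ne a$). Spinned words are words over $\mathcal A\cup\bar{\mathcal A}$, $\bar{\mathcal A}=\{\bar x:x\in\mathcal A\}$ (letters of $\mathcal A$ have spin $L$, of $\bar{\mathcal A}$ spin $R$); a spinned version of a word over $\mathcal A$ is obtained by possibly barring some of its letters. $\mu_a=L_a$, $\mu_{\bar a}=R_a$, $\mu_{\breve x_1\cdots\breve x_n}=\mu_{\breve x_1}\circ\cdots\circ\mu_{\breve x_n}$. An infinite word is episturmian if its set of factors is closed under reversal and it has at most one right special factor of each length. A spinned infinite word $\breve x_1\breve x_2\cdots$ directs $\mathbf t$ if there are recurrent infinite words $\mathbf t^{(n)}$ with $\mathbf t^{(0)}=\mathbf t$ and $\mathbf t^{(n-1)}=\mu_{\breve x_n}(\mathbf t^{(n)})$ for $n\ge1$. A finite word $u$ is a quasiperiod of an infinite word $\mathbf w$ if there are words $p_n$ ($n\ge0$) with $p_0=\varepsilon$, $|p_n|<|p_{n+1}|\le|p_nu|$,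 $p_nu$ a prefix of $\mathbf w$; $\mathbf w$ is quasiperiodic if it has a quasiperiod. *)

theory Defs
  imports "HOL-Library.Stream"
begin

text \<open>Finite words are lists, infinite words are streams; the alphabet is the element type.
  The morphisms are given by their values on letters.\<close>

definition L_mor :: "'a \<Rightarrow> 'a \<Rightarrow> 'a list" where
  "L_mor a b = (if b = a then [a] else [a, b])"

definition R_mor :: "'a \<Rightarrow> 'a \<Rightarrow> 'a list" where
  "R_mor a b = (if b = a then [a] else [b, a])"

text \<open>The function \<open>flat\<close> is the infinite concatenation only for streams of nonempty words,
  so this is meant for nonerasing \<open>f\<close>, such as \<open>L_mor a\<close> and \<open>R_mor a\<close>.\<close>

definition apply_mor :: "('a \<Rightarrow> 'b list) \<Rightarrow> 'a stream \<Rightarrow> 'b stream" where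
  "apply_mor f s = flat (smap f s)"

datatype 'a spinned = SpinL (letter: 'a) | SpinR (letter: 'a)

fun mu :: "'a spinned \<Rightarrow> 'a \<Rightarrow> 'a list" where
  "mu (SpinL a) = L_mor a"
| "mu (SpinR a) = R_mor a"

definition spinned_version :: "'a spinned stream \<Rightarrow> 'a stream \<Rightarrow> bool" where
  "spinned_version ys y \<longleftrightarrow> smap letter ys = y"

definition occurs_at :: "'a list \<Rightarrow> 'a stream \<Rightarrow> nat \<Rightarrow> bool" where
  "occurs_at u s i \<longleftrightarrow> stake (length u) (sdrop i s) = u"

definition factors :: "'a stream \<Rightarrow> 'a list set" where
  "factors s = {u. \<exists>i. occurs_at u s i}"

definition right_special :: "'a stream \<Rightarrow> 'a list \<Rightarrow> bool" where
  "right_special s u \<longleftrightarrow> (\<exists>a b. a \<noteq> b \<and> u @ [a] \<in> factors s \<and> u @ [b] \<in> factors s)"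

definition recurrent :: "'a stream \<Rightarrow> bool" where
  "recurrent s \<longleftrightarrow> (\<forall>u\<in>factors s. infinite {i. occurs_at u s i})"

definition episturmian :: "'a stream \<Rightarrow> bool" where
  "episturmian s \<longleftrightarrow>
     (\<forall>u\<in>factors s. rev u \<in> factors s) \<and>
     (\<forall>n. \<exists>\<^sub>\<le>\<^sub>1 u. length u = n \<and> right_special s u)"

text \<open>Streams are indexed from \<open>0\<close>, so \<open>x !! n\<close> is the letter with index \<open>n + 1\<close> of the
  directing word.\<close>

definition directs :: "'a spinned stream \<Rightarrow> 'a stream \<Rightarrow> bool" where
  "directs x t \<longleftrightarrow>
     (\<exists>T :: nat \<Rightarrow> 'a stream. T 0 = t \<and> (\<forall>n. recurrent (T n)) \<and>
        (\<forall>n. T n = apply_mor (mu (x !! n)) (T (Suc n))))"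

definition quasiperiod :: "'a list \<Rightarrow> 'a stream \<Rightarrow> bool" where
  "quasiperiod u w \<longleftrightarrow>
     (\<exists>p :: nat \<Rightarrow> 'a list. p 0 = [] \<and>
        (\<forall>n. length (p n) < length (p (Suc n)) \<and> length (p (Suc n)) \<le> length (p n @ u) \<and>
             occurs_at (p n @ u) w 0))"

definition quasiperiodic :: "'a stream \<Rightarrow> bool" where
  "quasiperiodic w \<longleftrightarrow> (\<exists>u. quasiperiod u w)"

end

theory Submission
  imports Defs "HOL-Library.Sublist" "HOL-Library.Infinite_Set"
begin

text \<open>
  Write \<open>\<psi>\<^sub>x\<close> for the composition of the \<open>L\<close>-morphisms along a word \<open>x\<close>, and \<open>Pal x\<close> for the word with
  \<open>Pal (a x) = L\<^sub>a(Pal x) a\<close>. If \<open>v\<close> contains all letters of \<open>s\<close>, then \<open>Pal v\<close> is a prefix of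
  \<open>\<psi>\<^sub>v(s')\<close> for every suffix \<open>s'\<close> of \<open>s\<close> and is at least as long as every \<open>\<psi>\<^sub>v(b)\<close>, so it is a
  quasiperiod of \<open>\<psi>\<^sub>v(s)\<close>; nonerasing morphisms preserve quasiperiodicity.

  Conversely, an episturmian word \<open>t\<close> has a letter \<open>a\<close> occurring in all factors of length two, so
  that \<open>t\<close> or \<open>a t\<close> is the image under \<open>L\<^sub>a\<close> of an episturmian word. Desubstituting until a
  quasiperiod \<open>q\<close> becomes empty yields \<open>x\<close> with \<open>Pal x = p q r\<close> and an episturmian \<open>T\<close> with
  \<open>p t = \<psi>\<^sub>x(T)\<close>, where the distances of the occurrences of \<open>q\<close> are the lengths of the \<open>\<psi>\<^sub>x(b)\<close>
  with \<open>b\<close> in \<open>T\<close>. These are at most the length of \<open>q\<close>. Let \<open>x = x' v\<close> with \<open>v = a v'\<close> the shortest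
  suffix containing all letters of \<open>T\<close>. Then \<open>\<psi>\<^sub>x(a) = \<psi>\<^sub>x\<^sub>'(Pal v)\<close> and \<open>Pal x = \<psi>\<^sub>x\<^sub>'(Pal v) Pal x'\<close>,
  so \<open>p\<close> is no longer than \<open>Pal x'\<close>, and the prefix \<open>p\<close> can be removed by turning some of the letters
  of \<open>x'\<close> from spin \<open>L\<close> to spin \<open>R\<close>.
\<close>

section \<open>Letter morphisms extended to finite and infinite words\<close>

definition mor :: "('a \<Rightarrow> 'b list) \<Rightarrow> 'a list \<Rightarrow> 'b list" where
  "mor f u = concat (map f u)"

lemma mor_simps [simp]:
  "mor f [] = []" "mor f (x # u) = f x @ mor f u" "mor f (u @ v) = mor f u @ mor f v"
  by (auto simp: mor_def)

lemma L_mor_simps [simp]: "L_mor a a = [a]" "b \<noteq> a \<Longrightarrow> L_mor a b = [a, b]"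
  by (simp_all add: L_mor_def)

lemma R_mor_simps [simp]: "R_mor a a = [a]" "b \<noteq> a \<Longrightarrow> R_mor a b = [b, a]"
  by (simp_all add: R_mor_def)

definition nonerasing :: "('a \<Rightarrow> 'b list) \<Rightarrow> bool" where
  "nonerasing f \<longleftrightarrow> (\<forall>x. f x \<noteq> [])"

lemma nonerasing_mor [simp]:
  "nonerasing (L_mor a)" "nonerasing (R_mor a)" "nonerasing (mu x)"
  by (cases x; auto simp: nonerasing_def L_mor_def R_mor_def)+

lemma apply_mor_SCons:
  "nonerasing f \<Longrightarrow> apply_mor f (x ## s) = f x @- apply_mor f s"
  unfolding apply_mor_def nonerasing_def by (subst flat_unfold) auto

lemma apply_mor_shift:
  "nonerasing f \<Longrightarrow> apply_mor f (u @- s) = mor f u @- apply_mor f s"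
  by (induction u) (auto simp: apply_mor_SCons)

lemma length_mor_ge: "nonerasing f \<Longrightarrow> length u \<le> length (mor f u)"
proof (induction u)
  case (Cons x u)
  then have "length (f x) \<ge> 1" by (cases "f x") (auto simp: nonerasing_def)
  with Cons show ?case by simp
qed simp

section \<open>Factors and recurrence\<close>

lemma shift_eq_shift_iff:
  "length u = length v \<Longrightarrow> u @- s = v @- t \<longleftrightarrow> u = v \<and> s = t"
  by (induction u v rule: list_induct2) auto

lemma shift_eq_shift_le:
  assumes "u @- s = v @- t" "length u \<le> length v"
  obtains w where "v = u @ w" "s = w @- t"
proof -
  have "u @- s = take (length u) v @- (drop (length u) v @- t)"
    using assms(1) by (simp flip: shift_append)
  then have "u = take (length u) v" "s = drop (length u) v @- t"
    using assms(2) by (auto simp: shift_eq_shift_iff)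
  then show ?thesis using that by (metis append_take_drop_id)
qed

lemma occurs_at_iff: "occurs_at u s i \<longleftrightarrow> (\<exists>p r. length p = i \<and> s = p @- u @- r)"
proof
  assume "occurs_at u s i"
  then have "sdrop i s = u @- sdrop (length u) (sdrop i s)"
    unfolding occurs_at_def by (metis stake_sdrop)
  then have "s = stake i s @- u @- sdrop (length u) (sdrop i s)" by (metis stake_sdrop)
  then show "\<exists>p r. length p = i \<and> s = p @- u @- r"
    by (intro exI[of _ "stake i s"] exI) auto
next
  assume "\<exists>p r. length p = i \<and> s = p @- u @- r"
  then show "occurs_at u s i" by (auto simp: occurs_at_def sdrop_shift stake_shift)
qed

lemma factors_iff: "u \<in> factors s \<longleftrightarrow> (\<exists>p r. s = p @- u @- r)"
  by (auto simp: factors_def occurs_at_iff)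

text \<open>Occurrences are recorded by their end position, because decoding works on prefixes that
  stop where an occurrence stops.\<close>

lemma factors_iff_suffix: "u \<in> factors s \<longleftrightarrow> (\<exists>e. suffix u (stake e s))"
proof
  assume "u \<in> factors s"
  then obtain p r where s: "s = p @- u @- r" by (auto simp: factors_iff)
  have "stake (length p + length u) s = p @ u" unfolding s by (simp add: stake_shift)
  then show "\<exists>e. suffix u (stake e s)" by (auto simp: suffix_def intro!: exI[of _ "length p + length u"])
next
  assume "\<exists>e. suffix u (stake e s)"
  then obtain e p where "stake e s = p @ u" by (auto simp: suffix_def)
  then have "s = p @- u @- sdrop e s" by (metis shift_append stake_sdrop)
  then show "u \<in> factors s" by (auto simp: factors_iff)
qed

lemma factors_append:
  assumes "p @ u @ r \<in> factors s" shows "u \<in> factors s"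
proof -
  obtain p' r' where "s = p' @- (p @ u @ r) @- r'" using assms by (auto simp: factors_iff)
  then have "s = (p' @ p) @- u @- (r @- r')" by simp
  then show ?thesis by (metis factors_iff)
qed

lemma factors_singleton: "[x] \<in> factors s \<longleftrightarrow> x \<in> sset s"
proof
  assume "x \<in> sset s"
  then obtain n where "x = s !! n" by (auto simp: sset_range)
  then have "s = stake n s @- [x] @- stl (sdrop n s)"
    by (simp add: id_stake_snth_sdrop flip: sdrop.simps(2))
  then show "[x] \<in> factors s" by (metis factors_iff)
qed (auto simp: factors_iff)

lemma recurrent_iff:
  "recurrent s \<longleftrightarrow> (\<forall>u\<in>factors s. \<forall>N. \<exists>p r. N \<le> length p \<and> s = p @- u @- r)"
  unfolding recurrent_def infinite_nat_iff_unbounded_le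
  by (simp add: occurs_at_iff) blast

lemma recurrentD:
  assumes "recurrent s" "u \<in> factors s"
  obtains p r where "N \<le> length p" "s = p @- u @- r"
  using assms unfolding recurrent_iff by blast

lemma stake_mor_prefix:
  assumes "nonerasing f" "n \<le> length (mor f (stake m s))"
  shows "prefix (stake n (apply_mor f s)) (mor f (stake m s))"
proof -
  have "apply_mor f s = mor f (stake m s) @- apply_mor f (sdrop m s)"
    by (metis apply_mor_shift assms(1) stake_sdrop)
  then have "stake n (apply_mor f s) = take n (mor f (stake m s))"
    using assms(2) by (simp add: stake_shift)
  then show ?thesis by (simp add: take_is_prefix)
qed

lemma recurrent_apply_mor:
  assumes f: "nonerasing f" and s: "recurrent s"
  shows "recurrent (apply_mor f s)"
  unfolding recurrent_iff
proof (intro ballI allI)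
  fix u N assume "u \<in> factors (apply_mor f s)"
  then obtain e where e: "suffix u (stake e (apply_mor f s))" by (auto simp: factors_iff_suffix)
  have "length (mor f (stake e s)) \<ge> e" using length_mor_ge[OF f, of "stake e s"] by simp
  from stake_mor_prefix[OF f this] e obtain a b where ab: "mor f (stake e s) = a @ u @ b"
    by (auto simp: suffix_def prefix_def)
  have "stake e s \<in> factors s" unfolding factors_iff_suffix by blast
  then obtain p r where pr: "N \<le> length p" "s = p @- stake e s @- r" using recurrentD[OF s] by blast
  have "apply_mor f s = (mor f p @ a) @- u @- (b @- apply_mor f r)"
    by (subst pr(2)) (simp add: apply_mor_shift f ab)
  moreover have "N \<le> length (mor f p @ a)" using pr(1) length_mor_ge[OF f, of p] by simp
  ultimately show "\<exists>p r. N \<le> length p \<and> apply_mor f s = p @- u @- r" by blast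
qed

text \<open>Every factor occurs again beyond \<open>p\<close>, so cutting \<open>p\<close> off loses
  none.\<close>

lemma factors_suffix_stream:
  assumes "recurrent (p @- s)"
  shows "factors s = factors (p @- s)"
proof
  show "factors s \<subseteq> factors (p @- s)"
    by (auto simp: factors_iff) (metis shift_append)
  show "factors (p @- s) \<subseteq> factors s"
  proof
    fix u assume "u \<in> factors (p @- s)"
    then obtain q r where "length p \<le> length q" "p @- s = q @- u @- r"
      using recurrentD[OF assms] by blast
    then show "u \<in> factors s" by (metis factors_iff shift_eq_shift_le)
  qed
qed

text \<open>Reversing a prefix that continues \<open>N\<close> letters past an occurrence of
  \<open>rev u\<close> gives a factor in which \<open>u\<close> has \<open>N\<close> letters before
  it.\<close>

lemma recurrent_if_factors_rev:
  assumes "\<And>u. u \<in> factors s \<Longrightarrow> rev u \<in> factors s"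
  shows "recurrent s"
  unfolding recurrent_iff
proof (intro ballI allI)
  fix u N assume "u \<in> factors s"
  then have "rev u \<in> factors s" by (rule assms)
  then obtain p r where s: "s = p @- rev u @- r" by (auto simp: factors_iff)
  have "s = [] @- (p @ rev u @ stake N r) @- sdrop N r" by (simp add: s stake_sdrop)
  then have "p @ rev u @ stake N r \<in> factors s" by (metis factors_iff)
  from assms[OF this] obtain p' r' where "s = p' @- (rev (stake N r) @ u @ rev p) @- r'"
    by (auto simp: factors_iff)
  then have "s = (p' @ rev (stake N r)) @- u @- (rev p @- r')" by simp
  moreover have "N \<le> length (p' @ rev (stake N r))" by simp
  ultimately show "\<exists>p r. N \<le> length p \<and> s = p @- u @- r" by blast
qed

lemma episturmian_recurrent: "episturmian s \<Longrightarrow> recurrent s"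
  by (rule recurrent_if_factors_rev) (auto simp: episturmian_def)

lemma episturmian_cong: "factors s = factors t \<Longrightarrow> episturmian s \<longleftrightarrow> episturmian t"
  by (simp add: episturmian_def right_special_def)

lemma sset_cong_factors: "factors s = factors t \<Longrightarrow> sset s = sset t"
  by (metis factors_singleton subsetI subset_antisym)

section \<open>Palindromic closures\<close>

text \<open>The closing \<open>a\<close> makes the image symmetric: every letter other than
  \<open>a\<close> has an \<open>a\<close> on both sides, so the word can be cut into blocks from
  either end.\<close>

definition L_ext :: "'a \<Rightarrow> 'a list \<Rightarrow> 'a list" where
  "L_ext a u = mor (L_mor a) u @ [a]"

lemma L_ext_Nil [simp]: "L_ext a [] = [a]"
  by (simp add: L_ext_def)

lemma L_ext_Cons: "L_ext a (x # u) = L_mor a x @ L_ext a u"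
  by (simp add: L_ext_def)

text \<open>The two morphisms are conjugate by \<open>a\<close>: the closing \<open>a\<close> can be
  moved to the front, one block at a time.\<close>

lemma L_ext_eq_R: "L_ext a u = a # mor (R_mor a) u"
  by (induction u) (auto simp: L_ext_def L_mor_def R_mor_def)

lemma L_ext_append_L: "L_ext a (u @ v) = mor (L_mor a) u @ L_ext a v"
  by (simp add: L_ext_def)

lemma L_ext_append_R: "L_ext a (u @ v) = L_ext a u @ mor (R_mor a) v"
  by (simp add: L_ext_eq_R)

lemma L_ext_append_sandwich: "L_ext a (u @ v @ w) = mor (L_mor a) u @ L_ext a v @ mor (R_mor a) w"
  by (simp only: L_ext_append_L[of a u] L_ext_append_R[of a v])

lemma L_ext_snoc: "L_ext a (u @ [x]) = L_ext a u @ R_mor a x"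
  by (simp add: L_ext_append_R)

lemma rev_L_ext: "rev (L_ext a u) = L_ext a (rev u)"
proof (induction u)
  case (Cons x u)
  then show ?case by (auto simp: L_ext_Cons L_ext_snoc L_mor_def R_mor_def)
qed simp

lemma length_L_ext: "length (L_ext a u) = Suc (length u + length (filter (\<lambda>x. x \<noteq> a) u))"
  by (induction u) (auto simp: L_ext_Cons L_mor_def)

lemma filter_L_ext: "filter (\<lambda>x. x \<noteq> a) (L_ext a u) = filter (\<lambda>x. x \<noteq> a) u"
  by (induction u) (auto simp: L_ext_Cons L_mor_def)

lemma suffix_snoc_iff: "suffix (u @ [x]) (v @ [y]) \<longleftrightarrow> x = y \<and> suffix u v"
  by (auto simp: suffix_def)

text \<open>Decoding from the right is unambiguous: the letter just before the closing
  \<open>a\<close> of \<open>L_ext a u\<close> is the last letter of \<open>u\<close>.\<close>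

lemma suffix_L_ext_iff: "suffix (L_ext a u) (L_ext a v) \<longleftrightarrow> suffix u v"
proof
  assume "suffix u v"
  then show "suffix (L_ext a u) (L_ext a v)" by (auto simp: suffix_def L_ext_append_L)
next
  show "suffix (L_ext a u) (L_ext a v) \<Longrightarrow> suffix u v"
  proof (induction u arbitrary: v rule: rev_induct)
    case (snoc x u)
    have "v \<noteq> []"
      using suffix_length_le[OF snoc.prems] by (auto simp: length_L_ext)
    then obtain w y where v: "v = w @ [y]" by (cases v rule: rev_cases) auto
    have *: "suffix (L_ext a u @ R_mor a x) (L_ext a w @ R_mor a y)"
      using snoc.prems by (simp add: v L_ext_snoc)
    have "x = y \<and> suffix (L_ext a u) (L_ext a w)"
    proof (cases "x = a"; cases "y = a")
      assume "x = a" "y = a"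
      then show ?thesis using * by (simp add: R_mor_def suffix_snoc_iff)
    next
      assume "x = a" "y \<noteq> a"
      then have "suffix (L_ext a u) (L_ext a w @ [y])"
        using * suffix_snoc_iff[of "L_ext a u" a "L_ext a w @ [y]" a] by (simp add: R_mor_def)
      then show ?thesis using \<open>y \<noteq> a\<close> by (simp only: L_ext_def suffix_snoc_iff) simp
    next
      assume "x \<noteq> a" "y = a"
      then have "suffix (L_ext a u @ [x]) (L_ext a w)"
        using * suffix_snoc_iff[of "L_ext a u @ [x]" a "L_ext a w" a] by (simp add: R_mor_def)
      then show ?thesis using \<open>x \<noteq> a\<close> by (simp only: L_ext_def suffix_snoc_iff) simp
    next
      assume "x \<noteq> a" "y \<noteq> a"
      then have "suffix (L_ext a u @ [x]) (L_ext a w @ [y])"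
        using * suffix_snoc_iff[of "L_ext a u @ [x]" a "L_ext a w @ [y]" a] by (simp add: R_mor_def)
      then show ?thesis by (simp add: suffix_snoc_iff)
    qed
    with snoc.IH v show ?case by (auto simp: suffix_snoc_iff)
  qed simp
qed

text \<open>Each \<open>a\<close> in the image starts a block or is the closing letter, so a suffix
  beginning with \<open>a\<close> cuts no block.\<close>

lemma suffix_of_L_ext:
  assumes "suffix (a # c) (L_ext a z)"
  obtains u where "a # c = L_ext a u"
proof -
  have "suffix (a # c) (L_ext a z) \<Longrightarrow> \<exists>u. a # c = L_ext a u"
  proof (induction z arbitrary: c rule: rev_induct)
    case Nil
    then show ?case by (intro exI[of _ "[]"]) (auto simp: suffix_Cons)
  next
    case (snoc y z)
    consider c' where "a # c = c' @ R_mor a y" "suffix c' (L_ext a z)" "c' \<noteq> []"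
      | "suffix (a # c) (R_mor a y)"
      using snoc.prems unfolding L_ext_snoc suffix_append by fastforce
    then show ?case
    proof cases
      case (1 c')
      then obtain c'' where "c' = a # c''" by (cases c') auto
      with 1 snoc.IH[of c''] obtain u where "c' = L_ext a u" by auto
      then have "a # c = L_ext a (u @ [y])" using 1 by (simp add: L_ext_snoc)
      then show ?thesis by blast
    next
      case 2
      then have "a # c = L_ext a []" by (auto simp: R_mor_def suffix_Cons split: if_splits)
      then show ?thesis by blast
    qed
  qed
  then show ?thesis using assms that by blast
qed

lemma L_ext_preceded:
  assumes "L_ext a z = r @ b # c" "b \<noteq> a"
  obtains r' where "r = r' @ [a]"
proof -
  have "L_ext a z = r @ b # c \<Longrightarrow> \<exists>r'. r = r' @ [a]"
  proof (induction z arbitrary: r)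
    case Nil
    then show ?case using assms(2) by (auto simp: Cons_eq_append_conv)
  next
    case (Cons x z)
    have IH: "L_ext a z = r1 @ b # c \<Longrightarrow> \<exists>r'. r1 = r' @ [a]" for r1 by (rule Cons.IH)
    show ?case
    proof (cases "x = a")
      case True
      then have *: "a # L_ext a z = r @ b # c" using Cons.prems by (simp add: L_ext_Cons L_mor_def)
      then obtain r1 where "r = a # r1" using assms(2) by (cases r) auto
      with * IH[of r1] show ?thesis by auto
    next
      case False
      then have *: "a # x # L_ext a z = r @ b # c" using Cons.prems by (simp add: L_ext_Cons L_mor_def)
      then obtain r1 where r1: "r = a # r1" using assms(2) by (cases r) auto
      show ?thesis
      proof (cases r1)
        case (Cons y r2)
        with * r1 IH[of r2] show ?thesis by auto
      qed (use r1 in simp)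
    qed
  qed
  then show ?thesis using assms that by blast
qed

section \<open>Compositions of the \<open>L\<close>-morphisms along a word\<close>

fun psi :: "'a list \<Rightarrow> 'a list \<Rightarrow> 'a list" where
  "psi [] u = u"
| "psi (a # xs) u = mor (L_mor a) (psi xs u)"

fun spsi :: "'a list \<Rightarrow> 'a stream \<Rightarrow> 'a stream" where
  "spsi [] s = s"
| "spsi (a # xs) s = apply_mor (L_mor a) (spsi xs s)"

text \<open>This is the iterated palindromic closure of the directive word, computed by Justin's
  formula. Recursion on the first letter matches desubstitution.\<close>

fun pal :: "'a list \<Rightarrow> 'a list" where
  "pal [] = []"
| "pal (a # xs) = L_ext a (pal xs)"

lemma psi_Nil [simp]: "psi xs [] = []"
  by (induction xs) auto

lemma psi_append_right: "psi xs (u @ v) = psi xs u @ psi xs v"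
  by (induction xs) auto

lemma psi_append_left: "psi (xs @ ys) u = psi xs (psi ys u)"
  by (induction xs) auto

lemma spsi_append_left: "spsi (xs @ ys) s = spsi xs (spsi ys s)"
  by (induction xs) auto

lemma spsi_shift: "spsi xs (u @- s) = psi xs u @- spsi xs s"
  by (induction xs) (auto simp: apply_mor_shift)

lemma pal_append: "pal (xs @ ys) = psi xs (pal ys) @ pal xs"
  by (induction xs) (auto simp: L_ext_def)

lemma length_psi_ge: "length u \<le> length (psi xs u)"
proof (induction xs)
  case (Cons a xs)
  then show ?case using length_mor_ge[OF nonerasing_mor(1), of "psi xs u" a] by simp
qed simp

lemma psi_notin: "x \<notin> set xs \<Longrightarrow> psi xs [x] = pal xs @ [x]"
  by (induction xs) (auto simp: L_ext_def L_mor_def)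

text \<open>If \<open>x\<close> occurs only as the first letter, \<open>psi_notin\<close> shows that
  its image is the whole of \<open>pal\<close>. Otherwise the prefix relation for the tail survives
  \<open>L_mor a\<close>.\<close>

lemma prefix_psi_pal: "x \<in> set xs \<Longrightarrow> prefix (psi xs [x]) (pal xs)"
proof (induction xs)
  case (Cons a xs)
  show ?case
  proof (cases "x \<in> set xs")
    case True
    with Cons.IH show ?thesis by (auto simp: prefix_def L_ext_def)
  next
    case False
    then show ?thesis using Cons.prems by (simp add: psi_notin L_ext_def L_mor_def)
  qed
qed simp

lemma length_psi_le: "length (psi xs [x]) \<le> Suc (length (pal xs))"
  by (cases "x \<in> set xs") (auto simp: psi_notin dest!: prefix_psi_pal prefix_length_le)

lemma apply_L_mor_hd: "\<exists>r. apply_mor (L_mor a) s = a ## r"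
  by (cases s) (auto simp: apply_mor_SCons L_mor_def)

lemma stream_eqI_snth: "(\<And>n. s !! n = t !! n) \<Longrightarrow> s = t"
  by (metis ext stream_smap_nats)

text \<open>This is the infinite form of \<open>L_ext_eq_R\<close>: changing a spin from L to R
  removes one leading letter.\<close>

lemma apply_L_mor_eq: "apply_mor (L_mor a) s = a ## apply_mor (R_mor a) s"
proof (rule stream_eqI_snth)
  fix n
  show "apply_mor (L_mor a) s !! n = (a ## apply_mor (R_mor a) s) !! n"
  proof (induction n arbitrary: s rule: less_induct)
    case (less n)
    obtain x s' where s: "s = x ## s'" by (cases s)
    have IH: "m < n \<Longrightarrow> apply_mor (L_mor a) s' !! m = (a ## apply_mor (R_mor a) s') !! m" for m
      by (rule less.IH)
    show ?case
    proof (cases "x = a")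
      case True
      then show ?thesis using IH[of "n - 1"]
        by (cases n) (auto simp: s apply_mor_SCons)
    next
      case False
      show ?thesis
      proof (cases n)
        case (Suc m)
        then show ?thesis using False IH[of "m - 1"]
          by (cases m) (auto simp: s apply_mor_SCons)
      qed (simp add: s apply_mor_SCons False)
    qed
  qed
qed

text \<open>Whatever follows, its image under \<open>L_mor a\<close> begins with \<open>a\<close>,
  which supplies the closing letter of \<open>L_ext a\<close>.\<close>

lemma pal_prefix_spsi: "\<exists>r. spsi xs s = pal xs @- r"
proof (induction xs)
  case (Cons a xs)
  then obtain r where "spsi xs s = pal xs @- r" by blast
  moreover obtain r' where "apply_mor (L_mor a) r = a ## r'" using apply_L_mor_hd[of a r] by auto
  ultimately show ?case by (auto simp: apply_mor_shift L_ext_def)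
qed simp

section \<open>Quasiperiods\<close>

lemma quasiperiod_iff:
  "quasiperiod u w \<longleftrightarrow> (\<exists>p. p 0 = [] \<and> (\<forall>n. length (p n) < length (p (Suc n)) \<and>
     length (p (Suc n)) \<le> length (p n @ u) \<and> (\<exists>r. w = p n @- u @- r)))"
  by (simp add: quasiperiod_def occurs_at_iff)

lemma quasiperiod_apply_mor:
  assumes f: "nonerasing f" and "quasiperiod u w"
  shows "quasiperiod (mor f u) (apply_mor f w)"
proof -
  obtain p where p: "p 0 = []" "\<And>n. length (p n) < length (p (Suc n))"
    "\<And>n. length (p (Suc n)) \<le> length (p n @ u)" "\<And>n. \<exists>r. w = p n @- u @- r"
    using assms(2) unfolding quasiperiod_iff by blast
  have "length (mor f (p n)) < length (mor f (p (Suc n))) \<and>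
      length (mor f (p (Suc n))) \<le> length (mor f (p n) @ mor f u) \<and>
      (\<exists>r. apply_mor f w = mor f (p n) @- mor f u @- r)" for n
  proof -
    obtain r where r: "w = (p n @ u) @- r" using p(4)[of n] by auto
    obtain r' where r': "w = p (Suc n) @- r'" using p(4)[of "Suc n"] by auto
    \<comment> \<open>The length bounds make \<open>p n\<close>, \<open>p (Suc n)\<close> and
      \<open>p n @ u\<close> nested prefixes of \<open>w\<close>, so their images are nested as
      well.\<close>
    obtain x where x: "p n @ u = p (Suc n) @ x"
      using shift_eq_shift_le[of "p (Suc n)" r' "p n @ u" r] p(3)[of n] r r' by auto
    obtain y where y: "p (Suc n) = p n @ y"
      using shift_eq_shift_le[of "p n" "u @- r" "p (Suc n)" r'] p(2)[of n] r r' by auto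
    have "length (mor f (p n)) < length (mor f (p (Suc n)))"
      using p(2)[of n] y length_mor_ge[OF f, of y] by auto
    moreover have "length (mor f (p (Suc n))) \<le> length (mor f (p n) @ mor f u)"
      using arg_cong[OF x, of "\<lambda>z. length (mor f z)"] by simp
    moreover have "apply_mor f w = mor f (p n) @- mor f u @- apply_mor f r"
      by (subst r) (simp only: apply_mor_shift[OF f] shift_append mor_simps)
    ultimately show ?thesis by blast
  qed
  then show ?thesis unfolding quasiperiod_iff using p(1) by (intro exI[of _ "mor f \<circ> p"]) auto
qed

lemma quasiperiod_pal:
  assumes "sset s \<subseteq> set v"
  shows "quasiperiod (pal v) (spsi v s)"
  unfolding quasiperiod_iff
proof (intro exI[of _ "\<lambda>n. psi v (stake n s)"] conjI allI)
  fix n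
  have S: "stake (Suc n) s = stake n s @ [s !! n]" by (rule stake_Suc)
  have "s !! n \<in> set v" using assms by (auto simp: sset_range)
  then show "length (psi v (stake (Suc n) s)) \<le> length (psi v (stake n s) @ pal v)"
    unfolding S by (auto simp: psi_append_right dest!: prefix_psi_pal prefix_length_le)
  show "length (psi v (stake n s)) < length (psi v (stake (Suc n) s))"
    unfolding S using length_psi_ge[of "[s !! n]" v] by (auto simp: psi_append_right)
  obtain r where "spsi v (sdrop n s) = pal v @- r" using pal_prefix_spsi by blast
  then have "spsi v s = psi v (stake n s) @- pal v @- r" by (metis spsi_shift stake_sdrop)
  then show "\<exists>r. spsi v s = psi v (stake n s) @- pal v @- r" by blast
qed simp

section \<open>Directive words\<close>

lemma directs_recurrent: "directs x t \<Longrightarrow> recurrent t"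
  by (auto simp: directs_def)

lemma directs_SCons:
  "directs (x ## xs) t \<longleftrightarrow> recurrent t \<and> (\<exists>t'. t = apply_mor (mu x) t' \<and> directs xs t')"
proof
  assume "directs (x ## xs) t"
  then obtain T where T: "T 0 = t" "\<forall>n. recurrent (T n)"
    "\<forall>n. T n = apply_mor (mu ((x ## xs) !! n)) (T (Suc n))" unfolding directs_def by blast
  have "T (Suc n) = apply_mor (mu (xs !! n)) (T (Suc (Suc n)))" for n
    by (rule T(3)[rule_format, of "Suc n", unfolded snth.simps stream.sel])
  then have "directs xs (T 1)" unfolding directs_def
    by (intro exI[of _ "\<lambda>n. T (Suc n)"] conjI allI) (rule arg_cong[of _ _ T], simp, use T(2) in blast)
  moreover have "t = apply_mor (mu x) (T 1)"
    using T(3)[rule_format, of 0, unfolded T(1)] by simp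
  moreover have "recurrent t" using T(2)[rule_format, of 0, unfolded T(1)] .
  ultimately show "recurrent t \<and> (\<exists>t'. t = apply_mor (mu x) t' \<and> directs xs t')" by blast
next
  assume "recurrent t \<and> (\<exists>t'. t = apply_mor (mu x) t' \<and> directs xs t')"
  then obtain T where T: "recurrent t" "t = apply_mor (mu x) (T 0)" "\<forall>n. recurrent (T n)"
    "\<forall>n. T n = apply_mor (mu (xs !! n)) (T (Suc n))" unfolding directs_def by blast
  have "recurrent (case_nat t T n) \<and>
      case_nat t T n = apply_mor (mu ((x ## xs) !! n)) (case_nat t T (Suc n))" for n
  proof (cases n)
    case (Suc m)
    then show ?thesis
      using T(3)[rule_format, of m] T(4)[rule_format, of m] by (simp only: nat.case snth.simps stream.sel)
  qed (use T(1,2) in simp)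
  then show "directs (x ## xs) t"
    unfolding directs_def by (intro exI[of _ "case_nat t T"] conjI allI) (rule nat.case(1), blast+)
qed

lemma directs_SConsI: "directs xs t \<Longrightarrow> directs (x ## xs) (apply_mor (mu x) t)"
  using directs_SCons directs_recurrent recurrent_apply_mor[OF nonerasing_mor(3)] by blast

lemma directs_SpinL_shift:
  "directs (map SpinL v @- xs) t \<longleftrightarrow> (\<exists>t'. t = spsi v t' \<and> directs xs t')"
proof (induction v arbitrary: t)
  case (Cons a v)
  show ?case
  proof
    assume "directs (map SpinL (a # v) @- xs) t"
    then show "\<exists>t'. t = spsi (a # v) t' \<and> directs xs t'" by (auto simp: directs_SCons Cons.IH)
  next
    assume "\<exists>t'. t = spsi (a # v) t' \<and> directs xs t'"
    then obtain t' where "t = apply_mor (mu (SpinL a)) (spsi v t')" "directs (map SpinL v @- xs) (spsi v t')"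
      using Cons.IH by auto
    then show "directs (map SpinL (a # v) @- xs) t" using directs_SConsI[of "map SpinL v @- xs" "spsi v t'" "SpinL a"] by simp
  qed
qed auto

section \<open>Letters of a directed word occur in its directive word\<close>

lemma count_list_mor:
  assumes "\<And>x. count_list (f x) b = (if x = b then 1 else 0)"
  shows "count_list (mor f u) b = count_list u b"
  by (induction u) (auto simp: assms)

lemma count_list_prefix: "prefix u v \<Longrightarrow> count_list u b \<le> count_list v b"
  by (auto simp: prefix_def)

text \<open>A letter missing from the directive word is mapped to a word of length two by every morphism,
  so that the distance between two of its occurrences would decrease forever along the sequence of
  desubstituted words.\<close>

lemma count_list_directs_le_1:
  assumes "directs ys t" "b \<notin> letter ` sset ys"
  shows "count_list (stake n t) b \<le> 1"
  using assms
proof (induction n arbitrary: ys t)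
  case (Suc n)
  obtain x zs where ys: "ys = x ## zs" by (cases ys)
  then obtain t' where t: "t = apply_mor (mu x) t'" and t': "directs zs t'"
    using Suc.prems(1) by (auto simp: directs_SCons)
  let ?f = "mu x"
  have b: "letter x \<noteq> b" "b \<notin> letter ` sset zs" using Suc.prems(2) ys by auto
  then have cf: "count_list (?f y) b = (if y = b then 1 else 0)" for y
    by (cases x) (auto simp: L_mor_def R_mor_def)
  have "length (?f b) = 2" using b by (cases x) (auto simp: L_mor_def R_mor_def)
  have len: "count_list u b \<ge> 1 \<Longrightarrow> length (mor ?f u) \<ge> Suc (length u)" for u
  proof (induction u)
    case (Cons y u)
    have "?f y \<noteq> []" using nonerasing_mor(3)[of x] unfolding nonerasing_def by blast
    then have "length (?f y) \<ge> 1" by (cases "?f y") auto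
    then show ?case
      using Cons \<open>length (?f b) = 2\<close> length_mor_ge[OF nonerasing_mor(3)[of x], of u]
      by (cases "y = b") auto
  qed simp
  have IH: "count_list (stake n t') b \<le> 1" by (rule Suc.IH[OF t' b(2)])
  show ?case
  \<comment> \<open>If \<open>b\<close> is missing from the first \<open>n\<close> letters of
    \<open>t'\<close>, one more letter adds at most one \<open>b\<close>. Otherwise the image of
    these \<open>n\<close> letters already has length at least \<open>n + 1\<close>.\<close>
  proof (cases "count_list (stake n t') b = 0")
    case True
    have "stake (Suc n) t' = stake n t' @ [t' !! n]" by (rule stake_Suc)
    then have "count_list (stake (Suc n) t') b \<le> 1" using True by simp
    moreover have "prefix (stake (Suc n) t) (mor ?f (stake (Suc n) t'))"
      unfolding t by (rule stake_mor_prefix) (use length_mor_ge[OF nonerasing_mor(3)[of x], of "stake (Suc n) t'"] in auto)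
    ultimately show ?thesis
      using count_list_prefix[of "stake (Suc n) t" "mor ?f (stake (Suc n) t')" b]
      by (simp add: count_list_mor[of ?f b, OF cf] del: stake.simps)
  next
    case False
    then have "prefix (stake (Suc n) t) (mor ?f (stake n t'))"
      unfolding t by (intro stake_mor_prefix) (use len[of "stake n t'"] in auto)
    then show ?thesis
      using IH count_list_prefix[of "stake (Suc n) t" "mor ?f (stake n t')" b]
      by (simp add: count_list_mor[of ?f b, OF cf] del: stake.simps)
  qed
qed simp

text \<open>Recurrence would put two occurrences of a missing letter into one prefix, against
  \<open>count_list_directs_le_1\<close>.\<close>

lemma sset_directs_subset:
  assumes "directs ys t"
  shows "sset t \<subseteq> letter ` sset ys"
proof (rule ccontr)
  assume "\<not> sset t \<subseteq> letter ` sset ys"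
  then obtain b where b: "b \<in> sset t" "b \<notin> letter ` sset ys" by auto
  have rec: "recurrent t" by (rule directs_recurrent[OF assms])
  obtain p r where t: "t = p @- [b] @- r"
    using b(1) by (auto simp: factors_iff simp flip: factors_singleton)
  obtain p' r' where p': "Suc (length p) \<le> length p'" "t = p' @- [b] @- r'"
    using recurrentD[OF rec] b(1) factors_singleton by metis
  obtain w where w: "p' = (p @ [b]) @ w"
    using shift_eq_shift_le[of "p @ [b]" r p' "[b] @- r'"] t p' by auto
  have "stake (length p' + 1) t = p @ [b] @ w @ [b]"
    by (subst p'(2)) (simp add: stake_shift w)
  then show False using count_list_directs_le_1[OF assms b(2), of "length p' + 1"] by simp
qed

lemma quasiperiodic_if_directs:
  assumes "directs (w @- (map SpinL v @- ys)) t" "letter ` sset ys \<subseteq> set v"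
  shows "quasiperiodic t"
  using assms(1)
proof (induction w arbitrary: t)
  case Nil
  then obtain t' where "t = spsi v t'" "directs ys t'" by (auto simp: directs_SpinL_shift)
  then show ?case
    using assms(2) sset_directs_subset[of ys t'] quasiperiod_pal[of t' v]
    unfolding quasiperiodic_def by blast
next
  case (Cons x w)
  then show ?case
    using quasiperiod_apply_mor[OF nonerasing_mor(3)] unfolding quasiperiodic_def
    by (fastforce simp: directs_SCons)
qed

section \<open>Desubstitution of episturmian words\<close>

lemma pair_in_factors: "[s !! k, s !! Suc k] \<in> factors s"
  unfolding factors_def occurs_at_def by (auto simp: numeral_2_eq_2 intro!: exI[of _ k])

text \<open>Take the right special letter, or any letter of \<open>t\<close> if there is none. Every
  other letter has a unique successor. If \<open>b c\<close> avoided \<open>a\<close>, then by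
  reversal \<open>c b\<close> would be a factor too, and \<open>t\<close> would stay in
  \<open>b\<close>, \<open>c\<close> forever, although \<open>a\<close> recurs.\<close>

lemma episturmian_separating_letter:
  assumes "episturmian t"
  obtains a where "a \<in> sset t" "\<And>b c. [b, c] \<in> factors t \<Longrightarrow> b = a \<or> c = a"
proof -
  have uniq: "x = y" if "right_special t [x]" "right_special t [y]" for x y
  proof -
    have "\<exists>\<^sub>\<le>\<^sub>1 u. length u = 1 \<and> right_special t u" using assms by (auto simp: episturmian_def)
    then have "[x] = [y]" using that by (intro Uniq_D[where P = "\<lambda>u. length u = 1 \<and> right_special t u"]) auto
    then show ?thesis by simp
  qed
  obtain a where a: "a \<in> sset t" "\<And>x. right_special t [x] \<Longrightarrow> x = a"
  proof (cases "\<exists>x. right_special t [x]")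
    case True
    then obtain x where x: "right_special t [x]" by blast
    then obtain y where "[] @ [x] @ [y] \<in> factors t" by (auto simp: right_special_def)
    then have "x \<in> sset t" using factors_append factors_singleton by metis
    with x uniq that show ?thesis by blast
  next
    case False
    with that show ?thesis using shd_sset by blast
  qed
  have succ: "y = z" if "x \<noteq> a" "[x, y] \<in> factors t" "[x, z] \<in> factors t" for x y z
    using a(2)[of x] that by (auto simp: right_special_def)
  have "b = a \<or> c = a" if bc: "[b, c] \<in> factors t" for b c
  proof (rule ccontr)
    assume "\<not> (b = a \<or> c = a)"
    then have ne: "b \<noteq> a" "c \<noteq> a" by auto
    have cb: "[c, b] \<in> factors t" using assms bc unfolding episturmian_def by force
    obtain p r where t: "t = p @- [b, c] @- r" using bc by (auto simp: factors_iff)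
    have all: "t !! (length p + n) \<in> {b, c}" for n
    proof (induction n)
      case 0
      then show ?case by (simp add: t)
    next
      case (Suc n)
      have "[t !! (length p + n), t !! (length p + Suc n)] \<in> factors t"
        using pair_in_factors[of t "length p + n"] by simp
      with Suc succ[of b] succ[of c] bc cb ne show ?case by auto
    qed
    obtain p' r' where p': "length p \<le> length p'" "t = p' @- [a] @- r'"
      using recurrentD[OF episturmian_recurrent[OF assms]] a(1) factors_singleton by metis
    have "t !! length p' = a" by (subst p'(2)) simp
    then show False using all[of "length p' - length p"] p'(1) ne by auto
  qed
  with a(1) that show ?thesis by blast
qed

text \<open>Here \<open>g\<close> reads the next encoded letter and \<open>h\<close> removes its
  block, with invariant \<open>P\<close>. Blocks are nonempty, so strong induction on the position
  compares the two streams.\<close>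

lemma apply_mor_decode:
  assumes f: "nonerasing f" and P: "P w"
    and step: "\<And>w. P w \<Longrightarrow> w = f (g w) @- h w \<and> P (h w)"
  shows "apply_mor f (smap g (siterate h w)) = w"
proof -
  define dec where "dec w = apply_mor f (smap g (siterate h w))" for w
  have dec: "dec w = f (g w) @- dec (h w)" for w
    unfolding dec_def by (subst siterate.code) (simp add: apply_mor_SCons f)
  have "P w \<Longrightarrow> dec w !! n = w !! n" for n
  proof (induction n arbitrary: w rule: less_induct)
    case (less n)
    have w: "w = f (g w) @- h w" "P (h w)" using step less.prems by blast+
    have ne: "f (g w) \<noteq> []" using f by (simp add: nonerasing_def)
    show ?case
    proof (cases "n < length (f (g w))")
      case True
      then show ?thesis by (subst dec, subst (3) w(1)) (simp add: shift_snth_less)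
    next
      case False
      then have "dec (h w) !! (n - length (f (g w))) = h w !! (n - length (f (g w)))"
        using w(2) ne less.IH[of "n - length (f (g w))" "h w"] by (cases "f (g w)") auto
      then show ?thesis using False by (subst dec, subst (3) w(1)) (simp add: shift_snth_ge)
    qed
  qed
  then show ?thesis using P unfolding dec_def[symmetric] by (intro stream_eqI_snth)
qed

lemma L_mor_decode:
  assumes "shd w = a" "\<And>n. w !! n = a \<or> w !! Suc n = a"
  obtains s where "w = apply_mor (L_mor a) s"
proof -
  \<comment> \<open>A block is \<open>[a]\<close> exactly when another \<open>a\<close> follows, so
    in both cases the decoded letter is the second letter of \<open>w\<close>.\<close>
  define h where "h w = (if shd (stl w) = a then stl w else stl (stl w))" for w :: "'a stream"
  define P where "P w \<longleftrightarrow> shd w = a \<and> (\<forall>n. w !! n = a \<or> w !! Suc n = a)" for w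
  have "apply_mor (L_mor a) (smap (\<lambda>w. shd (stl w)) (siterate h w)) = w"
  proof (rule apply_mor_decode[where P = P])
    fix w assume w: "P w"
    have "w = L_mor a (shd (stl w)) @- h w"
      using w by (cases w; cases "stl w") (auto simp: P_def L_mor_def h_def)
    moreover have "P (h w)"
    proof (cases "shd (stl w) = a")
      case True
      then show ?thesis
        using w unfolding P_def h_def by (auto simp flip: snth.simps(2))
    next
      case False
      have "w !! Suc 0 = a \<or> w !! Suc (Suc 0) = a" using w unfolding P_def by blast
      moreover have "stl (stl w) !! n = w !! Suc (Suc n)" for n by simp
      ultimately show ?thesis using False w unfolding P_def h_def
        by (metis snth.simps(1) snth.simps(2))
    qed
    ultimately show "w = L_mor a (shd (stl w)) @- h w \<and> P (h w)" by blast
  qed (use assms in \<open>auto simp: P_def\<close>)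
  then show ?thesis using that by metis
qed

text \<open>An \<open>a\<close> in the image always starts a block, so the prefix ending there
  consists of whole blocks and a closing \<open>a\<close>.\<close>

lemma stake_apply_L_mor:
  assumes "apply_mor (L_mor a) s !! n = a"
  shows "\<exists>m. stake (Suc n) (apply_mor (L_mor a) s) = L_ext a (stake m s)"
  using assms
proof (induction n arbitrary: s rule: less_induct)
  case (less n)
  obtain x s' where s: "s = x ## s'" by (cases s)
  have L: "apply_mor (L_mor a) s = L_mor a x @- apply_mor (L_mor a) s'"
    by (simp add: s apply_mor_SCons)
  show ?case
  proof (cases "n < length (L_mor a x)")
    case True
    then have "stake (Suc n) (apply_mor (L_mor a) s) = L_ext a (stake 0 s) \<or> n = 0 \<or> n = 1 \<and> x \<noteq> a"
      by (auto simp: L_mor_def split: if_splits)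
    moreover have "n = 1 \<Longrightarrow> x = a" using less.prems True by (cases "x = a") (auto simp: L)
    moreover have "n = 0 \<Longrightarrow> stake (Suc n) (apply_mor (L_mor a) s) = L_ext a (stake 0 s)"
      by (cases "x = a") (auto simp: L)
    ultimately show ?thesis by blast
  next
    case False
    define k where "k = n - length (L_mor a x)"
    have n: "n = length (L_mor a x) + k" using False by (simp add: k_def)
    have "k < n" using n by (auto simp: L_mor_def)
    moreover have "apply_mor (L_mor a) s' !! k = a" using less.prems by (simp add: L n shift_snth_ge)
    ultimately obtain m where m: "stake (Suc k) (apply_mor (L_mor a) s') = L_ext a (stake m s')"
      using less.IH by blast
    have "stake (Suc n) (apply_mor (L_mor a) s) = L_mor a x @ L_ext a (stake m s')"
      unfolding L m[symmetric] n by (simp add: stake_shift flip: add_Suc_right)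
    also have "\<dots> = L_ext a (stake (Suc m) s)" by (simp add: s L_ext_Cons)
    finally show ?thesis by blast
  qed
qed

lemma factors_L_mor_iff:
  assumes rec: "recurrent t" and a: "a \<in> sset t"
    and sep: "\<And>b c. [b, c] \<in> factors t \<Longrightarrow> b = a \<or> c = a"
    and E: "E = (if shd t = a then [] else [a])" and s: "E @- t = apply_mor (L_mor a) s"
  shows "u \<in> factors s \<longleftrightarrow> L_ext a u \<in> factors t"
proof
  assume "L_ext a u \<in> factors t"
  then have "L_ext a u \<in> factors (apply_mor (L_mor a) s)"
    unfolding s[symmetric] factors_iff by (metis shift_append)
  then obtain e where e: "suffix (L_ext a u) (stake e (apply_mor (L_mor a) s))"
    by (auto simp: factors_iff_suffix)
  then obtain n where n: "e = Suc n" by (cases e) (auto simp: L_ext_def)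
  have "suffix (mor (L_mor a) u @ [a]) (stake n (apply_mor (L_mor a) s) @ [apply_mor (L_mor a) s !! n])"
    using e unfolding n stake_Suc L_ext_def .
  then have "apply_mor (L_mor a) s !! n = a" by (simp only: suffix_snoc_iff)
  then obtain m where "stake e (apply_mor (L_mor a) s) = L_ext a (stake m s)"
    using stake_apply_L_mor[of a s n] unfolding n by blast
  then show "u \<in> factors s" using e by (auto simp: suffix_L_ext_iff factors_iff_suffix)
next
  assume "u \<in> factors s"
  then obtain p r where pr: "s = p @- u @- r" by (auto simp: factors_iff)
  obtain r' where r': "apply_mor (L_mor a) r = a ## r'" using apply_L_mor_hd[of a r] by auto
  have Et: "E @- t = mor (L_mor a) p @- L_ext a u @- r'"
    unfolding s pr by (simp add: apply_mor_shift r' L_ext_def)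
  show "L_ext a u \<in> factors t"
  proof (cases "shd t = a")
    case True
    then have "t = mor (L_mor a) p @- L_ext a u @- r'" using Et E by simp
    then show ?thesis by (metis factors_iff)
  next
    case False
    show ?thesis
    proof (cases p)
      case (Cons x p')
      then obtain p'' where "mor (L_mor a) p = a # p''" by (cases "x = a") auto
      then have "t = p'' @- L_ext a u @- r'" using Et E False by simp
      then show ?thesis by (metis factors_iff)
    next
      \<comment> \<open>This occurrence may use the \<open>a\<close> that \<open>E\<close> puts
        before \<open>t\<close>. By recurrence the rest of it occurs again further on, and there its
        first letter, which is not \<open>a\<close>, must be preceded by \<open>a\<close>.\<close>
      case Nil
      then have t: "t = mor (R_mor a) u @- r'" using Et E False by (simp add: L_ext_eq_R)
      show ?thesis
      proof (cases u)
        case Nil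
        then show ?thesis using a by (simp add: factors_singleton)
      next
        case (Cons y u')
        obtain b c where bc: "mor (R_mor a) u = b # c" using Cons by (cases "y = a") auto
        then have "b \<noteq> a" using t False by simp
        have "mor (R_mor a) u \<in> factors t" using t unfolding factors_iff by (metis shift.simps(1))
        then obtain p r where pr: "1 \<le> length p" "t = p @- mor (R_mor a) u @- r"
          using recurrentD[OF rec] by metis
        then obtain p' d where p: "p = p' @ [d]" by (cases p rule: rev_cases) auto
        have "t = p' @- (d # mor (R_mor a) u) @- r" using pr p by simp
        then have *: "d # mor (R_mor a) u \<in> factors t" by (metis factors_iff)
        then have "[] @ [d, b] @ c \<in> factors t" by (simp add: bc)
        then have "d = a" using sep \<open>b \<noteq> a\<close> factors_append by metis
        with * show ?thesis by (simp add: L_ext_eq_R)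
      qed
    qed
  qed
qed

lemma right_special_suffix:
  assumes "right_special s (p @ u)" shows "right_special s u"
proof -
  obtain a b where "a \<noteq> b" "p @ (u @ [a]) @ [] \<in> factors s" "p @ (u @ [b]) @ [] \<in> factors s"
    using assms by (auto simp: right_special_def)
  then show ?thesis unfolding right_special_def using factors_append by metis
qed

text \<open>Suffixes of right special factors are right special, and there is at most one of each
  length.\<close>

lemma right_special_suffix_comparable:
  assumes "episturmian s" "right_special s u" "right_special s v" "length u \<le> length v"
  shows "suffix u v"
proof -
  define w where "w = drop (length v - length u) v"
  have v: "v = take (length v - length u) v @ w" by (simp add: w_def)
  then have "right_special s w" using assms(3) right_special_suffix by metis
  moreover have "length w = length u" using assms(4) by (simp add: w_def)
  moreover have "\<exists>\<^sub>\<le>\<^sub>1 z. length z = length u \<and> right_special s z"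
    using assms(1) by (auto simp: episturmian_def)
  ultimately have "w = u"
    using assms(2) by (intro Uniq_D[where P = "\<lambda>z. length z = length u \<and> right_special s z"]) auto
  then show ?thesis using v by (metis suffix_def)
qed

lemma episturmian_desubstitute:
  assumes t: "episturmian t"
  obtains a s E where "a \<in> sset t" "\<And>b c. [b, c] \<in> factors t \<Longrightarrow> b = a \<or> c = a"
    "E = (if shd t = a then [] else [a])" "E @- t = apply_mor (L_mor a) s"
    "episturmian s" "sset s \<subseteq> sset t"
proof -
  obtain a where a: "a \<in> sset t" and sep: "\<And>b c. [b, c] \<in> factors t \<Longrightarrow> b = a \<or> c = a"
    using episturmian_separating_letter[OF t] by blast
  define E where "E = (if shd t = a then [] else [a])"
  have pairs: "t !! n = a \<or> t !! Suc n = a" for n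
    using sep pair_in_factors by metis
  obtain s where s: "E @- t = apply_mor (L_mor a) s"
  proof (rule L_mor_decode[of "E @- t" a])
    show "shd (E @- t) = a" by (simp add: E_def)
    show "(E @- t) !! n = a \<or> (E @- t) !! Suc n = a" for n
      using pairs[of n] pairs[of "n - 1"] by (cases n) (auto simp: E_def)
  qed
  have iff: "u \<in> factors s \<longleftrightarrow> L_ext a u \<in> factors t" for u
    using sep by (rule factors_L_mor_iff[OF episturmian_recurrent[OF t] a _ E_def s])
  have rs: "right_special t (L_ext a u)" if u: "right_special s u" for u
  proof -
    obtain x y where xy: "x \<noteq> y" "u @ [x] \<in> factors s" "u @ [y] \<in> factors s"
      using u by (auto simp: right_special_def)
    have "L_ext a u @ [z] \<in> factors t" if "u @ [z] \<in> factors s" for z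
    proof -
      have "L_ext a u @ R_mor a z \<in> factors t" using that by (simp add: iff L_ext_snoc)
      moreover obtain c where "R_mor a z = z # c" by (cases "z = a") auto
      ultimately have "[] @ (L_ext a u @ [z]) @ c \<in> factors t" by simp
      then show ?thesis by (rule factors_append)
    qed
    with xy show ?thesis by (auto simp: right_special_def)
  qed
  have "episturmian s" unfolding episturmian_def
  proof (intro conjI ballI allI)
    fix u assume "u \<in> factors s"
    then have "rev (L_ext a u) \<in> factors t" using t unfolding iff episturmian_def by blast
    then show "rev u \<in> factors s" by (simp add: iff rev_L_ext)
  next
    fix n
    show "\<exists>\<^sub>\<le>\<^sub>1 u. length u = n \<and> right_special s u"
    proof (rule Uniq_I)
      fix u v assume uv: "length u = n \<and> right_special s u" "length v = n \<and> right_special s v"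
      \<comment> \<open>The images of \<open>u\<close> and \<open>v\<close> may differ in length, so
        uniqueness in \<open>t\<close> is used as comparability of suffixes and then
        decoded.\<close>
      then have "suffix (L_ext a u) (L_ext a v) \<or> suffix (L_ext a v) (L_ext a u)"
        using right_special_suffix_comparable[OF t] rs by (meson nat_le_linear)
      then have "suffix u v \<or> suffix v u" by (simp only: suffix_L_ext_iff)
      moreover have "length u = length v" using uv by simp
      ultimately show "u = v" by (auto simp: suffix_def)
    qed
  qed
  moreover have "sset s \<subseteq> sset t"
  proof
    fix x assume "x \<in> sset s"
    then have *: "L_ext a [x] \<in> factors t" by (simp add: iff flip: factors_singleton)
    show "x \<in> sset t"
    proof (cases "x = a")
      case False
      then have "[a] @ [x] @ [a] \<in> factors t" using * by (simp add: L_ext_def L_mor_def)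
      then show ?thesis using factors_append factors_singleton by metis
    qed (use a in simp)
  qed
  ultimately show ?thesis using that a sep E_def s by blast
qed

text \<open>Desubstitution is iterated with spin L if the word starts with its separating letter and
  spin R otherwise. The alphabet never grows, so all letters of the directive word come from
  \<open>t\<close>.\<close>

lemma episturmian_directed:
  assumes "episturmian t"
  obtains ys where "directs ys t" "letter ` sset ys \<subseteq> sset t"
proof -
  have "\<exists>x s'. episturmian s \<longrightarrow> s = apply_mor (mu x) s' \<and> letter x \<in> sset s \<and>
      episturmian s' \<and> sset s' \<subseteq> sset s" for s :: "'a stream"
  proof (cases "episturmian s")
    case True
    then obtain a E s' where *: "a \<in> sset s" and "\<And>b c. [b, c] \<in> factors s \<Longrightarrow> b = a \<or> c = a"
      and **: "E = (if shd s = a then [] else [a])"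
      "E @- s = apply_mor (L_mor a) s'" "episturmian s'" "sset s' \<subseteq> sset s"
      by (rule episturmian_desubstitute) blast
    show ?thesis
    proof (cases "shd s = a")
      case True
      then show ?thesis using * ** by (intro exI[of _ "SpinL a"] exI[of _ s']) simp
    next
      case False
      then have "a ## s = a ## apply_mor (R_mor a) s'"
        using ** apply_L_mor_eq[of a s'] by simp
      then show ?thesis using * ** by (intro exI[of _ "SpinR a"] exI[of _ s']) simp
    qed
  qed blast
  then obtain X S where XS: "\<And>s :: 'a stream. episturmian s \<Longrightarrow> s = apply_mor (mu (X s)) (S s) \<and>
      letter (X s) \<in> sset s \<and> episturmian (S s) \<and> sset (S s) \<subseteq> sset s" by metis
  define T where "T n = (S ^^ n) t" for n
  have T: "episturmian (T n) \<and> sset (T n) \<subseteq> sset t" for n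
  proof (induction n)
    case (Suc n)
    then show ?case using XS[of "T n"] by (auto simp: T_def)
  qed (simp add: T_def assms)
  define ys where "ys = smap X (siterate S t)"
  have ys: "ys !! n = X (T n)" for n by (simp add: ys_def T_def)
  have "directs ys t" unfolding directs_def
  proof (intro exI[of _ T] conjI allI)
    fix n
    show "recurrent (T n)" using T episturmian_recurrent by blast
    have "T (Suc n) = S (T n)" by (simp add: T_def)
    then show "T n = apply_mor (mu (ys !! n)) (T (Suc n))" using XS T unfolding ys by metis
  qed (simp add: T_def)
  moreover have "letter ` sset ys \<subseteq> sset t"
    using XS T unfolding sset_range by (auto simp: ys) blast
  ultimately show ?thesis using that by blast
qed

section \<open>Decoding a quasiperiod\<close>

text \<open>A letter other than \<open>a\<close> has only \<open>a\<close> as neighbour. Hence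
  \<open>F\<close>, \<open>G\<close> and \<open>E\<close> add letters that are forced, or that were
  put before \<open>t\<close>, and the extended words begin and end at block boundaries.\<close>

lemma suffix_stake_desubstitute:
  assumes sep: "\<And>b c. [b, c] \<in> factors t \<Longrightarrow> b = a \<or> c = a"
    and E: "E = (if shd t = a then [] else [a])" and s: "E @- t = apply_mor (L_mor a) s"
    and q: "q \<noteq> []" "suffix q (stake e t)"
    and G: "G = (if last q = a then [] else [a])" and F: "F = (if hd q = a then [] else [a])"
  obtains m where "E @ stake e t @ G = L_ext a (stake m s)" "suffix (F @ q @ G) (L_ext a (stake m s))"
proof -
  obtain r where r: "stake e t = r @ q" using q(2) by (auto simp: suffix_def)
  obtain q' where q': "q = q' @ [last q]" using q(1) by (metis append_butlast_last_id)
  obtain k where k: "e = Suc k" using r q(1) by (cases e) auto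
  have lq: "t !! k = last q" using r q' unfolding k stake_Suc by (metis append_assoc last_snoc)
  have G': "stake e t @ G = stake (e + length G) t"
  proof (cases "last q = a")
    case False
    have "[t !! k, t !! e] \<in> factors t" using pair_in_factors[of t k] k by simp
    then have "t !! e = a" using sep False lq by metis
    then have "stake (Suc e) t = stake e t @ [a]" by (simp only: stake_Suc)
    then show ?thesis using False G by simp
  qed (simp add: G)
  define n where "n = length E + k + length G"
  have n: "stake (Suc n) (E @- t) = E @ stake e t @ G"
  proof -
    have "stake (Suc n) (E @- t) = E @ stake (e + length G) t"
      by (simp add: n_def k stake_shift del: stake.simps)
    then show ?thesis by (simp only: G')
  qed
  have "last (stake e t @ G) = a" using r q(1) G by auto
  then have "(E @- t) !! n = a"
    using arg_cong[OF n, of last] r q(1) unfolding stake_Suc[of n] by simp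
  then obtain m where m: "E @ stake e t @ G = L_ext a (stake m s)"
    using stake_apply_L_mor[of a s n] n unfolding s by metis
  have "suffix (F @ q @ G) (L_ext a (stake m s))"
  proof (cases "hd q = a")
    case True
    then show ?thesis using m r F by (auto simp: suffix_def) (metis append.assoc)
  next
    case False
    obtain b c where bc: "q = b # c" using q(1) by (cases q) auto
    have "L_ext a (stake m s) = (E @ r) @ b # (c @ G)" using m r bc by simp
    then obtain r' where "E @ r = r' @ [a]" using L_ext_preceded False bc by (metis list.sel(1))
    then have "L_ext a (stake m s) = r' @ (F @ q @ G)"
      using m r F False by (metis append.assoc)
    then show ?thesis by (auto simp: suffix_def)
  qed
  with m that show ?thesis by blast
qed

lemma filter_ne_length_ge1: "x \<in> set u \<Longrightarrow> x \<noteq> a \<Longrightarrow> 1 \<le> length (filter (\<lambda>x. x \<noteq> a) u)"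
  by (induction u) auto

text \<open>Extending a nonempty factor by the letters forced by the separating letter and desubstituting
  makes it shorter, unless it is a single letter; in that case the second occurrence moves to the
  left. The factor is eventually decoded to the empty word, whose occurrences are everywhere.\<close>

lemma episturmian_decode_factor:
  assumes "episturmian t" "e1 < e2" "suffix q (stake e1 t)" "suffix q (stake e2 t)"
  shows "\<exists>xs T D p r. episturmian T \<and> D @- t = spsi xs T \<and> pal xs = p @ q @ r \<and>
    (\<forall>e. suffix q (stake e t) \<longrightarrow> (\<exists>j. D @ stake e t @ r = psi xs (stake j T) @ pal xs))"
  using assms
proof (induction "length q + e2" arbitrary: q e1 e2 t rule: less_induct)
  case less
  show ?case
  proof (cases "q = []")
    case True
    then show ?thesis using less.prems(1)
      by (intro exI[of _ "[]"] exI[of _ t]) auto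
  next
    case False
    obtain a s E where a: "a \<in> sset t" and sep: "\<And>b c. [b, c] \<in> factors t \<Longrightarrow> b = a \<or> c = a"
      and E: "E = (if shd t = a then [] else [a])" and s: "E @- t = apply_mor (L_mor a) s"
      and epi: "episturmian s" and "sset s \<subseteq> sset t"
      using less.prems(1) by (rule episturmian_desubstitute) blast
    define G where "G = (if last q = a then [] else [a])"
    define F where "F = (if hd q = a then [] else [a])"
    have occ: "\<exists>m. E @ stake e t @ G = L_ext a (stake m s) \<and> suffix (F @ q @ G) (L_ext a (stake m s))"
      if "suffix q (stake e t)" for e
      by (rule suffix_stake_desubstitute[OF sep E s False that G_def F_def]) blast+
    obtain m1 where m1: "E @ stake e1 t @ G = L_ext a (stake m1 s)"
      "suffix (F @ q @ G) (L_ext a (stake m1 s))" using occ less.prems(3) by blast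
    obtain m2 where m2: "E @ stake e2 t @ G = L_ext a (stake m2 s)"
      "suffix (F @ q @ G) (L_ext a (stake m2 s))" using occ less.prems(4) by blast
    obtain c where c: "F @ q @ G = a # c" using False by (cases q; cases "hd q = a") (auto simp: F_def)
    obtain q' where q': "F @ q @ G = L_ext a q'"
      using suffix_of_L_ext[of a c] m1(2) unfolding c by metis
    have occ': "\<exists>m. E @ stake e t @ G = L_ext a (stake m s) \<and> suffix q' (stake m s)"
      if "suffix q (stake e t)" for e
      using occ[OF that] unfolding q' suffix_L_ext_iff .
    have suf: "suffix q' (stake m1 s)" "suffix q' (stake m2 s)"
      using m1(2) m2(2) unfolding q' suffix_L_ext_iff .
    let ?n = "\<lambda>u. length (filter (\<lambda>x. x \<noteq> a) u)"
    have lenE: "length E \<le> 1" "?n E = 0" by (auto simp: E)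
    have nG: "?n G = 0" by (simp add: G_def)
    have nF: "?n F = 0" by (simp add: F_def)
    have l1: "length E + e1 + length G = Suc (m1 + ?n (stake m1 s))"
      using arg_cong[OF m1(1), of length] by (simp add: length_L_ext)
    have l2: "length E + e2 + length G = Suc (m2 + ?n (stake m2 s))"
      using arg_cong[OF m2(1), of length] by (simp add: length_L_ext)
    have n2: "?n (stake m2 s) = ?n (stake e2 t)"
      using arg_cong[OF m2(1), of ?n] lenE nG by (simp add: filter_L_ext)
    have "m1 < m2"
    proof (rule ccontr)
      assume "\<not> m1 < m2"
      then have "stake m1 s = stake m2 s @ stake (m1 - m2) (sdrop m2 s)"
        by (simp add: stake_add)
      then have "?n (stake m2 s) \<le> ?n (stake m1 s)"
        by (metis filter_append length_append le_add1)
      then show False using l1 l2 \<open>\<not> m1 < m2\<close> less.prems(2) by linarith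
    qed
    have lq: "length F + length q + length G = Suc (length q' + ?n q)"
    proof -
      have "?n q = ?n q'" using arg_cong[OF q', of ?n] nF nG by (simp add: filter_L_ext)
      then show ?thesis using arg_cong[OF q', of length] by (simp add: length_L_ext)
    qed
    have F_le: "length F \<le> ?n q" "length F \<le> 1"
      using filter_ne_length_ge1[of "hd q" q a] False by (auto simp: F_def)
    \<comment> \<open>If \<open>q\<close> ends in \<open>a\<close>, then \<open>q'\<close> is
      shorter than \<open>q\<close> and \<open>m2\<close> is at most \<open>e2\<close>. Otherwise
      \<open>q'\<close> is at most as long as \<open>q\<close>, but the last letter of
      \<open>q\<close> stands at both end positions; these two blocks of length two force
      \<open>m2 < e2\<close>.\<close>
    have "length q' + m2 < length q + e2"
    proof (cases "last q = a")
      case True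
      then have "G = []" by (simp add: G_def)
      then show ?thesis using lq l2 F_le lenE by simp
    next
      case neq: False
      then have G1: "length G = 1" by (simp add: G_def)
      have q1: "1 \<le> ?n q" using filter_ne_length_ge1[of "last q" q a] False neq by simp
      define x where "x = stake (e2 - e1) (sdrop e1 t)"
      have e2: "stake e2 t = stake e1 t @ x" using less.prems(2) by (simp add: x_def stake_add)
      have "x \<noteq> []" using less.prems(2) by (simp add: x_def)
      moreover have "last (stake e2 t) = last q" using less.prems(4) False by (auto simp: suffix_def)
      ultimately have "last q \<in> set x" unfolding e2 by (metis last_appendR last_in_set)
      then have "1 \<le> ?n x" using neq filter_ne_length_ge1 by metis
      moreover have "1 \<le> ?n (stake e1 t)" using less.prems(3) q1 by (auto simp: suffix_def)
      ultimately have "2 \<le> ?n (stake e2 t)" unfolding e2 by simp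
      then show ?thesis using lq l2 n2 q1 G1 F_le lenE by linarith
    qed
    from less.hyps[OF this epi \<open>m1 < m2\<close> suf] obtain xs T D p r where
      IH: "episturmian T" "D @- s = spsi xs T" "pal xs = p @ q' @ r"
        "\<And>e. suffix q' (stake e s) \<Longrightarrow> \<exists>j. D @ stake e s @ r = psi xs (stake j T) @ pal xs" by blast
    \<comment> \<open>By the two readings of \<open>L_ext a\<close>, left contexts are mapped by
      \<open>L_mor a\<close> and right contexts by \<open>R_mor a\<close>.\<close>
    let ?D = "mor (L_mor a) D @ E" and ?r = "G @ mor (R_mor a) r"
    have D: "?D @- t = spsi (a # xs) T"
      using s by (simp add: apply_mor_shift flip: IH(2))
    have pal: "pal (a # xs) = (mor (L_mor a) p @ F) @ q @ ?r"
    proof -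
      have "pal (a # xs) = mor (L_mor a) p @ (F @ q @ G) @ mor (R_mor a) r"
        unfolding q' pal.simps IH(3) by (rule L_ext_append_sandwich)
      then show ?thesis by simp
    qed
    have occs: "\<exists>j. ?D @ stake e t @ ?r = psi (a # xs) (stake j T) @ pal (a # xs)"
      if e: "suffix q (stake e t)" for e
    proof -
      obtain m where m: "E @ stake e t @ G = L_ext a (stake m s)" "suffix q' (stake m s)"
        using occ'[OF e] by blast
      obtain j where j: "D @ stake m s @ r = psi xs (stake j T) @ pal xs"
        using IH(4)[OF m(2)] by blast
      have "?D @ stake e t @ ?r
          = mor (L_mor a) D @ (E @ stake e t @ G) @ mor (R_mor a) r" by simp
      also have "\<dots> = L_ext a (D @ stake m s @ r)"
        unfolding m(1) by (rule L_ext_append_sandwich[symmetric])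
      also have "\<dots> = psi (a # xs) (stake j T) @ pal (a # xs)"
        unfolding j by (simp add: L_ext_append_L)
      finally show ?thesis by blast
    qed
    show ?thesis
      by (rule exI[of _ "a # xs"], rule exI[of _ T], rule exI[of _ ?D],
          rule exI[of _ "mor (L_mor a) p @ F"], rule exI[of _ ?r]) (use IH(1) D pal occs in blast)
  qed
qed

text \<open>The numbers \<open>e n\<close> are end positions of occurrences, and each corresponds to
  a boundary between blocks \<open>psi xs [T !! j]\<close>. By recurrence \<open>x\<close> occurs
  after the first of these boundaries, so its block fits between two consecutive ones, which are at
  most \<open>L\<close> apart.\<close>

lemma psi_lengths_le_quasiperiod:
  assumes T: "recurrent T"
    and occ: "\<And>n. \<exists>j. A + e n = length (psi xs (stake j T)) + B"
    and e: "\<And>n. e n < e (Suc n)" "\<And>n. e (Suc n) \<le> e n + L"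
    and x: "x \<in> sset T"
  shows "length (psi xs [x]) \<le> L"
proof -
  define g where "g j = length (psi xs (stake j T))" for j
  have g_Suc: "g (Suc j) = g j + length (psi xs [T !! j])" for j
    unfolding g_def stake_Suc by (simp add: psi_append_right)
  have g_mono: "i \<le> j \<Longrightarrow> g i \<le> g j" for i j
    by (rule lift_Suc_mono_le[of g]) (simp_all add: g_Suc)
  obtain J where J: "\<And>n. A + e n = g (J n) + B" using occ unfolding g_def by metis
  have J_less: "J n < J (Suc n)" for n
  proof (rule ccontr)
    assume "\<not> J n < J (Suc n)"
    then have "g (J (Suc n)) \<le> g (J n)" by (intro g_mono) simp
    then show False using J[of n] J[of "Suc n"] e(1)[of n] by linarith
  qed
  have J_ge: "n \<le> J n" for n
  proof (induction n)
    case (Suc n)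
    then show ?case using J_less[of n] by linarith
  qed simp
  have between: "J 0 \<le> j \<Longrightarrow> j < J n \<Longrightarrow> \<exists>k. J k \<le> j \<and> j < J (Suc k)" for j n
  proof (induction n)
    case (Suc n)
    then show ?case by (cases "j < J n") (auto simp: not_less)
  qed simp
  obtain p r where p: "J 0 \<le> length p" "T = p @- [x] @- r"
    using recurrentD[OF T] x factors_singleton by metis
  let ?j = "length p"
  have Tj: "T !! ?j = x" by (subst p(2)) simp
  obtain k where k: "J k \<le> ?j" "?j < J (Suc k)"
    using between[OF p(1), of "Suc ?j"] J_ge[of "Suc ?j"] by auto
  have "g (J k) \<le> g ?j" "g (Suc ?j) \<le> g (J (Suc k))" using k by (auto intro: g_mono)
  then show ?thesis using J[of k] J[of "Suc k"] e(2)[of k] g_Suc[of ?j] unfolding Tj by linarith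
qed

text \<open>The lengths of the words removable by turning a letter of \<open>xs\<close> from spin \<open>L\<close> to spin \<open>R\<close>
  exceed the sum of the previous ones by at most one, so that every prefix of \<open>pal xs\<close> is removed
  by a suitable choice of spins.\<close>

lemma directs_shift_spins:
  assumes "p @- t = spsi xs s" "length p \<le> length (pal xs)" "directs ys s"
  shows "\<exists>w. directs (w @- ys) t"
  using assms
proof (induction xs arbitrary: p s ys rule: rev_induct)
  case Nil
  then show ?case by (intro exI[of _ "[]"]) simp
next
  case (snoc x xs)
  have pt: "p @- t = spsi xs (apply_mor (L_mor x) s)" using snoc.prems(1) by (simp add: spsi_append_left)
  have len: "length p \<le> length (psi xs [x]) + length (pal xs)"
    using snoc.prems(2) by (simp add: pal_append)
  show ?case
  proof (cases "length p \<le> length (pal xs)")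
    case True
    have "directs (SpinL x ## ys) (apply_mor (L_mor x) s)"
      using directs_SConsI[OF snoc.prems(3), of "SpinL x"] by simp
    from snoc.IH[OF pt True this] obtain w where "directs (w @- SpinL x ## ys) t" by blast
    then have "directs ((w @ [SpinL x]) @- ys) t" by simp
    then show ?thesis by blast
  next
    case False
    \<comment> \<open>Spin R at \<open>x\<close> drops the leading \<open>x\<close>, and so removes
      \<open>psi xs [x]\<close> after applying the morphisms of \<open>xs\<close>.\<close>
    have "p @- t = psi xs [x] @- spsi xs (apply_mor (R_mor x) s)"
      using pt spsi_shift[of xs "[x]"] by (simp add: apply_L_mor_eq)
    moreover have "length (psi xs [x]) \<le> length p" using False length_psi_le[of xs x] by linarith
    ultimately obtain p' where p': "p = psi xs [x] @ p'" "p' @- t = spsi xs (apply_mor (R_mor x) s)"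
      by (metis shift_eq_shift_le)
    have "directs (SpinR x ## ys) (apply_mor (R_mor x) s)"
      using directs_SConsI[OF snoc.prems(3), of "SpinR x"] by simp
    moreover have "length p' \<le> length (pal xs)" using p'(1) len by simp
    ultimately obtain w where "directs (w @- SpinR x ## ys) t" using snoc.IH[OF p'(2)] by blast
    then have "directs ((w @ [SpinR x]) @- ys) t" by simp
    then show ?thesis by blast
  qed
qed

text \<open>Letters are dropped from the front until the next loss would uncover \<open>A\<close>.
  That \<open>a\<close> is missing from \<open>zs\<close> later allows \<open>psi_notin\<close> to
  be applied to it.\<close>

lemma shortest_covering_suffix:
  assumes "A \<noteq> {}" "A \<subseteq> set xs"
  obtains ys a zs where "xs = ys @ a # zs" "a \<in> A" "a \<notin> set zs" "A \<subseteq> set (a # zs)"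
proof -
  have "A \<subseteq> set xs \<Longrightarrow> \<exists>ys a zs. xs = ys @ a # zs \<and> a \<in> A \<and> a \<notin> set zs \<and> A \<subseteq> set (a # zs)"
  proof (induction xs)
    case (Cons x xs)
    show ?case
    proof (cases "A \<subseteq> set xs")
      case True
      with Cons.IH obtain ys a zs where
        "xs = ys @ a # zs" "a \<in> A" "a \<notin> set zs" "A \<subseteq> set (a # zs)" by blast
      then show ?thesis by (intro exI[of _ "x # ys"] exI[of _ a] exI[of _ zs]) simp
    next
      case False
      then show ?thesis using Cons.prems by (intro exI[of _ "[]"] exI[of _ x] exI[of _ xs]) auto
    qed
  qed (use assms(1) in simp)
  with assms(2) that show ?thesis by blast
qed

lemma directs_if_quasiperiod:
  assumes t: "episturmian t" and q: "quasiperiod q t"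
  shows "\<exists>w v ys. directs (w @- (map SpinL v @- ys)) t \<and> letter ` sset ys \<subseteq> set v"
proof -
  obtain f where f: "f 0 = []" "\<And>n. length (f n) < length (f (Suc n))"
    "\<And>n. length (f (Suc n)) \<le> length (f n @ q)" "\<And>n. \<exists>r. t = f n @- q @- r"
    using q unfolding quasiperiod_iff by blast
  define e where "e n = length (f n) + length q" for n
  have stake_e: "stake (e n) t = f n @ q" for n
  proof -
    obtain r where "t = (f n @ q) @- r" using f(4)[of n] by auto
    then show ?thesis by (simp add: e_def stake_shift)
  qed
  have suf: "suffix q (stake (e n) t)" for n unfolding stake_e by (simp add: suffix_def)
  have e: "e n < e (Suc n)" "e (Suc n) \<le> e n + length q" for n
    using f(2,3)[of n] by (simp_all add: e_def)
  from episturmian_decode_factor[OF t e(1) suf suf] obtain xs T D p r where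
    T: "episturmian T" and D: "D @- t = spsi xs T" and pal: "pal xs = p @ q @ r"
    and occ: "\<And>e. suffix q (stake e t) \<Longrightarrow> \<exists>j. D @ stake e t @ r = psi xs (stake j T) @ pal xs"
    by blast
  have len: "length (psi xs [x]) \<le> length q" if "x \<in> sset T" for x
  proof (rule psi_lengths_le_quasiperiod[where e = e, OF episturmian_recurrent[OF T] _ e that])
    fix n
    obtain j where "D @ stake (e n) t @ r = psi xs (stake j T) @ pal xs" using occ[OF suf] by blast
    from arg_cong[OF this, of length]
    show "\<exists>j. (length D + length r) + e n = length (psi xs (stake j T)) + length (pal xs)"
      by (intro exI[of _ j]) simp
  qed
  have "sset T \<subseteq> set xs"
  proof
    fix x assume x: "x \<in> sset T"
    show "x \<in> set xs"
    proof (rule ccontr)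
      assume "x \<notin> set xs"
      \<comment> \<open>A missing letter would have an image one letter longer than
        \<open>pal xs\<close>, which already contains \<open>q\<close>.\<close>
      then show False using len[OF x] by (simp add: psi_notin pal)
    qed
  qed
  moreover have "sset T \<noteq> {}" using shd_sset by fastforce
  ultimately obtain xs1 a v where v: "xs = xs1 @ a # v" "a \<in> sset T" "a \<notin> set v" "sset T \<subseteq> set (a # v)"
    using shortest_covering_suffix[of "sset T" xs] by metis
  have "psi xs [a] = psi xs1 (pal (a # v))"
    using v(3) by (simp add: v(1) psi_append_left psi_notin L_ext_def)
  moreover have "pal xs = psi xs1 (pal (a # v)) @ pal xs1" unfolding v(1) by (rule pal_append)
  \<comment> \<open>Compare lengths in \<open>p @ q @ r = psi xs [a] @ pal xs1\<close>, where
    \<open>psi xs [a]\<close> is at most as long as \<open>q\<close>.\<close>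
  ultimately have p_le: "length p \<le> length (pal xs1)"
    using len[OF v(2)] arg_cong[OF pal, of length] by simp
  \<comment> \<open>The occurrence of \<open>q\<close> at the start of \<open>t\<close> locates
    \<open>D\<close>: cancelling \<open>q @ r\<close> leaves whole blocks followed by
    \<open>p\<close>. The blocks are removed by dropping \<open>j\<close> letters of
    \<open>T\<close>.\<close>
  obtain j where "D @ stake (e 0) t @ r = psi xs (stake j T) @ pal xs" using occ[OF suf] by blast
  then have "D = psi xs (stake j T) @ p" by (simp add: stake_e f(1) pal)
  moreover have "spsi xs T = psi xs (stake j T) @- spsi xs (sdrop j T)"
    by (metis spsi_shift stake_sdrop)
  ultimately have pt: "p @- t = spsi xs1 (spsi (a # v) (sdrop j T))"
    using D by (simp add: shift_eq_shift_iff v(1) spsi_append_left)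
  have fac: "factors (sdrop j T) = factors T"
    using factors_suffix_stream[of "stake j T" "sdrop j T"] episturmian_recurrent[OF T]
    by (simp add: stake_sdrop)
  then have "episturmian (sdrop j T)" using T episturmian_cong by blast
  then obtain ys where ys: "directs ys (sdrop j T)" "letter ` sset ys \<subseteq> sset (sdrop j T)"
    by (rule episturmian_directed)
  have "directs (map SpinL (a # v) @- ys) (spsi (a # v) (sdrop j T))"
    using ys(1) unfolding directs_SpinL_shift by blast
  from directs_shift_spins[OF pt p_le this]
  obtain w where "directs (w @- (map SpinL (a # v) @- ys)) t" by blast
  moreover have "letter ` sset ys \<subseteq> set (a # v)"
    using ys(2) v(4) sset_cong_factors[OF fac] by blast
  ultimately show ?thesis by blast
qed

theorem theorem4p28:
  fixes t :: "'a::finite stream"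
  assumes "episturmian t"
  shows "quasiperiodic t \<longleftrightarrow>
    (\<exists>(w :: 'a spinned list) (v :: 'a list) (y :: 'a stream) (ys :: 'a spinned stream).
        spinned_version ys y \<and>
        directs (w @- (map SpinL v @- ys)) t \<and>
        set v = sset (v @- y))"
proof
  assume "quasiperiodic t"
  then obtain w v ys where *: "directs (w @- (map SpinL v @- ys)) t" "letter ` sset ys \<subseteq> set v"
    using directs_if_quasiperiod[OF assms] unfolding quasiperiodic_def by blast
  have "set v = sset (v @- smap letter ys)" using *(2) by (auto simp: stream.set_map)
  with *(1) show "\<exists>w v y ys. spinned_version ys y \<and> directs (w @- (map SpinL v @- ys)) t \<and>
      set v = sset (v @- y)" unfolding spinned_version_def by blast
next
  assume "\<exists>w v y ys. spinned_version ys y \<and> directs (w @- (map SpinL v @- ys)) t \<and>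
      set v = sset (v @- y)"
  then obtain w v ys where *: "directs (w @- (map SpinL v @- ys)) t"
    "set v = sset (v @- smap letter ys)" unfolding spinned_version_def by blast
  have "letter ` sset ys \<subseteq> set v" by (subst *(2)) (auto simp: stream.set_map)
  with *(1) show "quasiperiodic t" by (rule quasiperiodic_if_directs)
qed

end
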